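(* Let $n\ge 2$ and let $\epsilon=(\epsilon^{(1)},\ldots,\epsilon^{(n)})^T$ be a random vector in $\mathbb{R}^n$ with finite mean whose distribution is absolutely continuous with respect to the Lebesgue measure (with density $f_\epsilon$) and fully supported on $\mathbb{R}^n$, and such that its surplus function $E$ is twice differentiable. For $i\ne j$ let $g_{i,j}$ be the probability density function of the difference $\epsilon^{(j)}-\epsilon^{(i)}$, and suppose that the differences $\epsilon^{(j)}-\epsilon^{(i)}$ have modes $\bar z_{i,j}\in\mathbb{R}$, $i\neq j$. Then the convex conjugate $E^*$ of $E$ is $\beta$-strongly convex with respect to the norm $\|\cdot\|_1$, where $$\beta=\frac{1}{2\sum_{i=1}^{n}\sum_{j\neq i} g_{i,j}(\bar z_{i,j})}.$$
   Context: The surplus function is $E(u)=\mathbb{E}_\epsilon\left(\max_{1\le i\le n}\left(u^{(i)}+\epsilon^{(i)}\right)\right)$, $u\in\mathbb{R}^n$. Its convex conjugate is $E^*(p)=\sup_{u\in\mathbb{R}^n}\left(\langle p,u\rangle-E(u)\right)$; it is finite exactly on the simplex $\Delta=\{p\in\mathbb{R}^n\mid \sum_{i=1}^n p^{(i)}=1,\ p^{(i)}\ge 0\}$. The density of $\epsilon^{(j)}-\epsilon^{(i)}$ is the real-valued function $$g_{i,j}(z)=\int_{\mathbb{R}^{n-2}}\int_{-\infty}^{\infty} f_\epsilon\left(y^{(-i,j)}+x^{(i)},\,z+x^{(i)},\,x^{(i)}\right)\,dx^{(i)}\,dy^{(-i,j)},$$ where the arguments of $f_\epsilon$ are listed so that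 $x^{(i)}$ is the value of the $i$-th coordinate, $z+x^{(i)}$ the value of the $j$-th coordinate, and $y^{(-i,j)}+x^{(i)}$ (with $y^{(-i,j)}\in\mathbb{R}^{n-2}$ and $x^{(i)}$ added to each component) the values of the remaining coordinates. A mode of $\epsilon^{(j)}-\epsilon^{(i)}$ is any point $\bar z_{i,j}\in\mathbb{R}$ that maximizes $g_{i,j}$ over $\mathbb{R}$. With $\|x\|_1=\sum_i|x^{(i)}|$, $E^*:\Delta\to\mathbb{R}$ is $\beta$-strongly convex with respect to $\|\cdot\|_1$ ($\beta>0$) if for all $p,q\in\Delta$ and $\alpha\in[0,1]$: $E^*(\alpha p+(1-\alpha)q)\le\alpha E^*(p)+(1-\alpha)E^*(q)-\frac{\beta}{2}\alpha(1-\alpha)\|p-q\|_1^2$. *)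

theory Defs
  imports "HOL-Probability.Probability"
begin

definition surplus :: "'a measure \<Rightarrow> ('a \<Rightarrow> real ^ 'n) \<Rightarrow> real ^ 'n \<Rightarrow> real" where
  "surplus M X u = (\<integral>\<omega>. (MAX i. u $ i + X \<omega> $ i) \<partial>M)"

definition convex_conjugate :: "('a::real_inner \<Rightarrow> real) \<Rightarrow> 'a \<Rightarrow> ereal" where
  "convex_conjugate F p = (SUP u. ereal (p \<bullet> u - F u))"

definition prob_simplex :: "(real ^ 'n) set" where
  "prob_simplex = {p. (\<Sum>i\<in>UNIV. p $ i) = 1 \<and> (\<forall>i. 0 \<le> p $ i)}"

definition l1_norm :: "real ^ 'n \<Rightarrow> real" where
  "l1_norm x = (\<Sum>i\<in>UNIV. \<bar>x $ i\<bar>)"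

text \<open>The finiteness clause says that \<open>F\<close> is a real-valued function on \<open>S\<close>, so
  that no infinite values enter the inequality.\<close>

definition strongly_convex_l1_on :: "(real ^ 'n) set \<Rightarrow> real \<Rightarrow> (real ^ 'n \<Rightarrow> ereal) \<Rightarrow> bool" where
  "strongly_convex_l1_on S \<beta> F \<longleftrightarrow>
     0 < \<beta> \<and> (\<forall>p\<in>S. \<bar>F p\<bar> \<noteq> \<infinity>) \<and>
     (\<forall>p\<in>S. \<forall>q\<in>S. \<forall>\<alpha>\<in>{0..1::real}.
        F (\<alpha> *\<^sub>R p + (1 - \<alpha>) *\<^sub>R q)
          \<le> ereal \<alpha> * F p + ereal (1 - \<alpha>) * F q
             - ereal (\<beta> / 2 * \<alpha> * (1 - \<alpha>) * (l1_norm (p - q))\<^sup>2))"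

definition twice_differentiable ::
    "('a::real_normed_vector \<Rightarrow> 'b::real_normed_vector) \<Rightarrow> bool" where
  "twice_differentiable F \<longleftrightarrow>
     (\<exists>F' :: 'a \<Rightarrow> 'a \<Rightarrow>\<^sub>L 'b. (\<forall>u. (F has_derivative blinfun_apply (F' u)) (at u)) \<and>
        (\<forall>u. F' differentiable (at u)))"

definition measure_support :: "'a::topological_space measure \<Rightarrow> 'a set" where
  "measure_support \<mu> = {x. \<forall>U. open U \<and> x \<in> U \<longrightarrow> 0 < emeasure \<mu> U}"

text \<open>If \<open>f\<close> is the joint density of a random vector with coordinates \<open>\<epsilon> i\<close>, then, for
  \<open>i \<noteq> j\<close>, this is the density of \<open>\<epsilon> j - \<epsilon> i\<close> at \<open>z\<close>. The vectors \<open>y\<close> are indexed by the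
  remaining coordinates; if there are none, the outer integral is over a one-point space of
  mass 1.\<close>

definition diff_density_ext :: "(real ^ 'n \<Rightarrow> real) \<Rightarrow> 'n \<Rightarrow> 'n \<Rightarrow> real \<Rightarrow> ennreal" where
  "diff_density_ext f i j z =
     (\<integral>\<^sup>+ y. (\<integral>\<^sup>+ x. ennreal (f (\<chi> k. if k = i then x else if k = j then z + x else y k + x)) \<partial>lborel)
        \<partial>(\<Pi>\<^sub>M k\<in>UNIV - {i, j}. lborel))"

text \<open>Meaningful only where the integral above is finite.\<close>

definition diff_density :: "(real ^ 'n \<Rightarrow> real) \<Rightarrow> 'n \<Rightarrow> 'n \<Rightarrow> real \<Rightarrow> real" where
  "diff_density f i j z = enn2real (diff_density_ext f i j z)"

definition is_mode :: "(real \<Rightarrow> real) \<Rightarrow> real \<Rightarrow> bool" where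
  "is_mode g z \<longleftrightarrow> (\<forall>w. g w \<le> g z)"

end

theory Submission
  imports Defs
begin

text \<open>
  Strong convexity of a conjugate with respect to \<open>\<parallel>\<cdot>\<parallel>\<^sub>1\<close> is dual to smoothness with respect to
  the maximum norm, so it suffices to bound how far \<open>E\<close> can bend upwards. Write \<open>G\<^sub>i\<^sub>j\<close> for the
  maximum of the density of \<open>\<epsilon>\<^sub>j - \<epsilon>\<^sub>i\<close>, and \<open>\<Sigma>\<close> for the sum of all \<open>G\<^sub>i\<^sub>j\<close> with \<open>i \<noteq> j\<close>.
  The smoothness estimate is obtained without differentiating \<open>E\<close>.

  Let \<open>i\<close> attain the maximum of \<open>a = u + \<epsilon>\<close>. After a perturbation \<open>s\<close> of \<open>u\<close>, the maximum exceeds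
  \<open>a\<^sub>i + s\<^sub>i\<close> only if some \<open>j\<close> overtakes \<open>i\<close>, that is if \<open>0 \<le> a\<^sub>i - a\<^sub>j < s\<^sub>j - s\<^sub>i\<close>, and the
  excess is then \<open>(s\<^sub>j - s\<^sub>i) - (a\<^sub>i - a\<^sub>j)\<close> for the best such \<open>j\<close>. Summing over all pairs gives a
  pointwise bound whose correction terms do not depend on the maximiser
  (\<open>Max_add_le_hinge\<close>). As \<open>\<epsilon>\<^sub>j - \<epsilon>\<^sub>i\<close> has a density bounded by \<open>G\<^sub>i\<^sub>j\<close>, and by \<open>G\<^sub>j\<^sub>i\<close> after
  reflection, each correction has expectation at most
  \<open>min G\<^sub>i\<^sub>j G\<^sub>j\<^sub>i \<cdot> max(0, s\<^sub>j - s\<^sub>i)\<^sup>2 / 2\<close> (\<open>expectation_hinge_le\<close>). For each pair only one of the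
  two orientations contributes, so for \<open>max\<^sub>k \<bar>s\<^sub>k\<bar> \<le> t\<close> the corrections add up to at most
  \<open>\<Sigma> t\<^sup>2\<close> (\<open>sum_max_square_le\<close>).

  Perturbing \<open>u\<close> by \<open>(1 - \<alpha>) s\<close> and by \<open>- \<alpha> s\<close> with weights \<open>\<alpha>\<close> and \<open>1 - \<alpha>\<close> cancels the
  linear terms \<open>s\<^sub>i\<close> and gives
  \<open>\<alpha> E(u + (1 - \<alpha>) s) + (1 - \<alpha>) E(u - \<alpha> s) \<le> E(u) + \<alpha> (1 - \<alpha>) \<Sigma> t\<^sup>2\<close>
  (\<open>surplus_smooth\<close>). Testing the suprema \<open>E\<^sup>*(p)\<close> and \<open>E\<^sup>*(q)\<close> at these two points, with \<open>s\<close> the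
  multiple of the sign vector of \<open>p - q\<close> that makes the gain largest, yields strong convexity
  with constant \<open>1 / (2 \<Sigma>)\<close> (\<open>strongly_convex_conjugate_if_smooth\<close>).
\<close>

section \<open>Upper bound for the maximum of a perturbed vector\<close>

text \<open>
  The amount by which a coordinate that trails the maximum by \<open>z \<ge> 0\<close> overtakes it after
  gaining \<open>c\<close> on it. The value is set to \<open>0\<close> for \<open>z < 0\<close>, so that pairs whose first member is
  exceeded by the second do not contribute.
\<close>

definition hinge :: "real \<Rightarrow> real \<Rightarrow> real" where
  "hinge c z = max 0 (c - z) * indicator {0..} z"

lemma hinge_nonneg: "0 \<le> hinge c z"
  by (simp add: hinge_def)

lemma hinge_le: "hinge c z \<le> max 0 c"
  by (auto simp: hinge_def indicator_def)

lemma hinge_measurable [measurable]: "hinge c \<in> borel_measurable borel"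
  unfolding hinge_def[abs_def] by measurable

lemma nn_integral_hinge:
  "(\<integral>\<^sup>+z. ennreal (hinge c z) \<partial>lborel) = ennreal ((max 0 c)\<^sup>2 / 2)"
proof -
  define b where "b = max 0 c"
  have "b \<ge> 0"
    by (simp add: b_def)
  have "(\<integral>\<^sup>+z. ennreal (hinge c z) \<partial>lborel)
      = (\<integral>\<^sup>+z. ennreal (b - z) * indicator {0..b} z \<partial>lborel)"
    by (intro nn_integral_cong) (auto simp: hinge_def b_def indicator_def max_def)
  also have "\<dots> = ennreal ((b * b - b\<^sup>2 / 2) - (b * 0 - 0\<^sup>2 / 2))"
    using \<open>b \<ge> 0\<close>
    by (intro nn_integral_FTC_Icc) (auto intro!: derivative_eq_intros)
  finally show ?thesis
    by (simp add: b_def power2_eq_square)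
qed

text \<open>
  The sum runs over all pairs, not only over those starting at the maximiser \<open>i\<close>. The superfluous
  terms are nonnegative, and with them the sum is a fixed measurable function of \<open>a\<close>, so that
  no measurable choice of a maximiser is needed.
\<close>

lemma Max_add_le_hinge:
  fixes a s :: "'n::finite \<Rightarrow> real"
  assumes i: "\<And>k. a k \<le> a i"
  shows "(MAX k. a k + s k)
    \<le> a i + s i + (\<Sum>i\<in>UNIV. \<Sum>j\<in>UNIV - {i}. hinge (s j - s i) (a i - a j))"
    (is "_ \<le> _ + ?S")
proof -
  have "a k + s k \<le> a i + s i + ?S" for k
  proof (cases "k = i")
    case True
    then show ?thesis
      by (auto intro!: sum_nonneg hinge_nonneg)
  next
    case False
    have "a k + s k - (a i + s i) \<le> hinge (s k - s i) (a i - a k)"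
      using i[of k] by (simp add: hinge_def)
    also have "\<dots> \<le> (\<Sum>j\<in>UNIV - {i}. hinge (s j - s i) (a i - a j))"
      using False by (intro member_le_sum) (auto simp: hinge_nonneg)
    also have "\<dots> \<le> ?S"
      by (rule member_le_sum[where i=i and f="\<lambda>i. \<Sum>j\<in>UNIV - {i}. hinge (s j - s i) (a i - a j)"])
         (auto intro!: sum_nonneg hinge_nonneg)
    finally show ?thesis by simp
  qed
  then show ?thesis
    by (subst Max_le_iff) auto
qed

section \<open>The density of a difference of two coordinates\<close>

text \<open>
  Lebesgue measure is invariant under the shear that keeps coordinate \<open>i\<close> and measures all other
  coordinates relative to it.
\<close>

lemma lborel_eq_distr_shifted:
  fixes i j :: "'n::finite"
  assumes "i \<noteq> j"
  defines "T \<equiv> \<lambda>(x::real, z::real, y::'n \<Rightarrow> real).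
      (\<chi> k. if k = i then x else if k = j then z + x else y k + x) :: real ^ 'n"
  defines "P \<equiv> lborel \<Otimes>\<^sub>M lborel \<Otimes>\<^sub>M (\<Pi>\<^sub>M k\<in>UNIV - {i, j}. lborel)"
  shows "T \<in> P \<rightarrow>\<^sub>M borel" "lborel = distr P borel T"
proof -
  interpret product_sigma_finite "\<lambda>k::'n. lborel :: real measure" ..
  let ?K = "UNIV - {i, j}"
  let ?Y = "\<Pi>\<^sub>M k\<in>?K. (lborel :: real measure)"
  interpret Y: sigma_finite_measure ?Y
    by (rule sigma_finite) auto
  interpret ZY: pair_sigma_finite "lborel :: real measure" ?Y ..
  show T: "T \<in> P \<rightarrow>\<^sub>M borel"
  proof (subst borel_measurable_euclidean_space, rule ballI)
    fix b :: "real ^ 'n"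
    assume "b \<in> Basis"
    then obtain k where b: "b = axis k 1"
      by (auto simp: Basis_vec_def)
    consider "k = i" | "k = j" "k \<noteq> i" | "k \<in> ?K"
      by auto
    then show "(\<lambda>w. T w \<bullet> b) \<in> borel_measurable P"
      by cases (auto simp: T_def P_def b inner_axis split_def)
  qed
  show "lborel = distr P borel T"
  proof (rule lborel_eqI)
    fix l u :: "real ^ 'n"
    assume le: "\<And>b. b \<in> Basis \<Longrightarrow> l \<bullet> b \<le> u \<bullet> b"
    have le': "l $ k \<le> u $ k" for k
      using le[of "axis k 1"] by (auto simp: inner_axis Basis_vec_def)
    \<comment> \<open>For a fixed value \<open>x\<close> of coordinate \<open>i\<close>, the preimage of the box is a product of intervals
      translated by \<open>- x\<close>, whose measure does not depend on \<open>x\<close>.\<close>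
    let ?A = "\<lambda>x. Pi\<^sub>E ?K (\<lambda>k. {l $ k - x <..< u $ k - x})"
    have mem: "indicator (box l u) (T (x, z, y)) =
        (indicator {l $ i <..< u $ i} x * (indicator {l $ j - x <..< u $ j - x} z * indicator (?A x) y) :: ennreal)"
      if "y \<in> space ?Y" for x z y
    proof -
      have "T (x, z, y) \<in> box l u \<longleftrightarrow> x \<in> {l $ i <..< u $ i} \<and> z \<in> {l $ j - x <..< u $ j - x}
          \<and> y \<in> ?A x"
      proof -
        have all: "(\<forall>k. Q k) \<longleftrightarrow> Q i \<and> Q j \<and> (\<forall>k\<in>?K. Q k)" for Q :: "'n \<Rightarrow> bool"
          by blast
        have "y \<in> ?A x \<longleftrightarrow> (\<forall>k\<in>?K. l $ k - x < y k \<and> y k < u $ k - x)"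
          using that by (simp add: PiE_iff space_PiM)
        moreover have "T (x, z, y) $ i = x" "T (x, z, y) $ j = z + x"
          "\<And>k. k \<in> ?K \<Longrightarrow> T (x, z, y) $ k = y k + x"
          using \<open>i \<noteq> j\<close> by (simp_all add: T_def)
        ultimately show ?thesis
          unfolding mem_box_cart all by (simp add: diff_less_eq less_diff_eq)
      qed
      then show ?thesis
        by (auto simp: indicator_def)
    qed
    have "emeasure (distr P borel T) (box l u) = (\<integral>\<^sup>+w. indicator (box l u) (T w) \<partial>P)"
      using nn_integral_distr[OF T, of "indicator (box l u)"] by simp
    also have "\<dots> = (\<integral>\<^sup>+x. \<integral>\<^sup>+z. \<integral>\<^sup>+y. indicator (box l u) (T (x, z, y)) \<partial>?Y \<partial>lborel \<partial>lborel)"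
    proof -
      have [measurable]: "T \<in> lborel \<Otimes>\<^sub>M lborel \<Otimes>\<^sub>M ?Y \<rightarrow>\<^sub>M borel"
        using T by (simp add: P_def)
      show ?thesis
        unfolding P_def
        by (subst ZY.P.nn_integral_fst[symmetric], measurable)
           (subst Y.nn_integral_fst[symmetric], measurable)
    qed
    also have "\<dots> = (\<integral>\<^sup>+x. \<integral>\<^sup>+z. \<integral>\<^sup>+y. indicator {l $ i <..< u $ i} x *
        (indicator {l $ j - x <..< u $ j - x} z * indicator (?A x) y) \<partial>?Y \<partial>lborel \<partial>lborel)"
      by (intro nn_integral_cong mem)
    also have "\<dots> = (\<integral>\<^sup>+x. indicator {l $ i <..< u $ i} x *
        (ennreal (u $ j - l $ j) * (\<Prod>k\<in>?K. ennreal (u $ k - l $ k))) \<partial>lborel)"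
    proof (intro nn_integral_cong)
      fix x :: real
      have "emeasure ?Y (?A x) = (\<Prod>k\<in>?K. ennreal (u $ k - l $ k))"
        using le' by (subst emeasure_PiM) auto
      moreover have "?A x \<in> sets ?Y"
        by (intro sets_PiM_I_finite) auto
      ultimately show "(\<integral>\<^sup>+z. \<integral>\<^sup>+y. indicator {l $ i <..< u $ i} x *
        (indicator {l $ j - x <..< u $ j - x} z * indicator (?A x) y) \<partial>?Y \<partial>lborel) =
        indicator {l $ i <..< u $ i} x *
        (ennreal (u $ j - l $ j) * (\<Prod>k\<in>?K. ennreal (u $ k - l $ k)))"
        using le'[of j] by (simp add: nn_integral_cmult nn_integral_multc)
    qed
    also have "\<dots> = ennreal (u $ i - l $ i) *
        (ennreal (u $ j - l $ j) * (\<Prod>k\<in>?K. ennreal (u $ k - l $ k)))"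
      using le'[of i] by (simp add: nn_integral_multc)
    also have "\<dots> = (\<Prod>k\<in>insert i (insert j ?K). ennreal (u $ k - l $ k))"
      using \<open>i \<noteq> j\<close> by (simp add: prod.insert)
    also have "insert i (insert j ?K) = UNIV"
      by auto
    also have "(\<Prod>k\<in>UNIV. ennreal (u $ k - l $ k)) = ennreal (\<Prod>k\<in>UNIV. u $ k - l $ k)"
      using le' by (intro prod_ennreal) auto
    also have "(\<Prod>k\<in>UNIV. u $ k - l $ k) = (\<Prod>b\<in>Basis. (u - l) \<bullet> b)"
    proof -
      have basis: "(Basis :: (real ^ 'n) set) = range (\<lambda>k. axis k 1)"
        by (auto simp: Basis_vec_def)
      have inj: "inj (\<lambda>k :: 'n. axis k (1 :: real))"
        by (auto simp: inj_on_def axis_eq_axis)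
      show ?thesis
        by (subst basis, subst prod.reindex[OF inj]) (simp add: inner_axis)
    qed
    finally show "emeasure (distr P borel T) (box l u) = (\<Prod>b\<in>Basis. (u - l) \<bullet> b)" .
  qed simp
qed

text \<open>This identifies \<open>diff_density_ext f i j\<close> as the density of \<open>v\<^sub>j - v\<^sub>i\<close> when \<open>v\<close> has density \<open>f\<close>.\<close>

lemma nn_integral_diff_density:
  fixes i j :: "'n::finite" and f :: "real ^ 'n \<Rightarrow> real"
  assumes ij: "i \<noteq> j"
    and f [measurable]: "(\<lambda>x. ennreal (f x)) \<in> borel_measurable borel"
    and h [measurable]: "h \<in> borel_measurable borel"
  shows "(\<integral>\<^sup>+v. ennreal (f v) * h (v $ j - v $ i) \<partial>lborel)
    = (\<integral>\<^sup>+z. diff_density_ext f i j z * h z \<partial>lborel)"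
proof -
  interpret product_sigma_finite "\<lambda>k::'n. lborel :: real measure" ..
  let ?Y = "\<Pi>\<^sub>M k\<in>UNIV - {i, j}. (lborel :: real measure)"
  interpret Y: sigma_finite_measure ?Y
    by (rule sigma_finite) auto
  interpret XY: pair_sigma_finite "lborel :: real measure" ?Y ..
  interpret ZY: sigma_finite_measure "lborel \<Otimes>\<^sub>M ?Y"
    by (rule sigma_finite_pair_measure) unfold_locales
  interpret XZY: pair_sigma_finite "lborel :: real measure" "lborel \<Otimes>\<^sub>M ?Y" ..
  define T where "T = (\<lambda>(x::real, z::real, y::'n \<Rightarrow> real).
      (\<chi> k. if k = i then x else if k = j then z + x else y k + x) :: real ^ 'n)"
  note TT = lborel_eq_distr_shifted[OF ij, folded T_def]
  note T [measurable] = TT(1)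
  have [measurable]: "(\<lambda>v::real^'n. v $ k) \<in> borel_measurable borel" for k
    by (intro borel_measurable_continuous_onI continuous_intros)
  have T': "T (x, z, y) $ j - T (x, z, y) $ i = z" for x z y
    using ij by (simp add: T_def)
  have "(\<integral>\<^sup>+v. ennreal (f v) * h (v $ j - v $ i) \<partial>lborel)
    = (\<integral>\<^sup>+w. ennreal (f (T w)) * h (T w $ j - T w $ i) \<partial>(lborel \<Otimes>\<^sub>M lborel \<Otimes>\<^sub>M ?Y))"
    by (subst TT(2), subst nn_integral_distr) measurable
  also have "\<dots> = (\<integral>\<^sup>+w. \<integral>\<^sup>+x. ennreal (f (T (x, w))) * h (T (x, w) $ j - T (x, w) $ i) \<partial>lborel \<partial>(lborel \<Otimes>\<^sub>M ?Y))"
    by (rule XZY.nn_integral_snd[symmetric]) measurable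
  also have "\<dots> = (\<integral>\<^sup>+z. \<integral>\<^sup>+y. \<integral>\<^sup>+x. ennreal (f (T (x, z, y))) * h (T (x, z, y) $ j - T (x, z, y) $ i) \<partial>lborel \<partial>?Y \<partial>lborel)"
    by (subst Y.nn_integral_fst[symmetric]) measurable
  also have "\<dots> = (\<integral>\<^sup>+z. (\<integral>\<^sup>+y. \<integral>\<^sup>+x. ennreal (f (T (x, z, y))) \<partial>lborel \<partial>?Y) * h z \<partial>lborel)"
  proof (unfold T', rule nn_integral_cong)
    fix z :: real
    have [measurable]: "(\<lambda>x. T (x, z, y)) \<in> borel \<rightarrow>\<^sub>M borel" if "y \<in> space ?Y" for y
      using measurable_compose[OF _ T, of "\<lambda>x. (x, z, y)" borel] that by simp
    have "(\<integral>\<^sup>+y. \<integral>\<^sup>+x. ennreal (f (T (x, z, y))) * h z \<partial>lborel \<partial>?Y)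
      = (\<integral>\<^sup>+y. (\<integral>\<^sup>+x. ennreal (f (T (x, z, y))) \<partial>lborel) * h z \<partial>?Y)"
      by (intro nn_integral_cong nn_integral_multc) measurable
    also have "\<dots> = (\<integral>\<^sup>+y. \<integral>\<^sup>+x. ennreal (f (T (x, z, y))) \<partial>lborel \<partial>?Y) * h z"
      by (intro nn_integral_multc) measurable
    finally show "(\<integral>\<^sup>+y. \<integral>\<^sup>+x. ennreal (f (T (x, z, y))) * h z \<partial>lborel \<partial>?Y)
      = (\<integral>\<^sup>+y. \<integral>\<^sup>+x. ennreal (f (T (x, z, y))) \<partial>lborel \<partial>?Y) * h z" .
  qed
  also have "\<dots> = (\<integral>\<^sup>+z. diff_density_ext f i j z * h z \<partial>lborel)"
    by (simp add: diff_density_ext_def T_def)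
  finally show ?thesis .
qed


lemma nn_integral_difference_le:
  fixes X :: "'a \<Rightarrow> real ^ 'n"
  assumes X: "distributed M lborel X (\<lambda>x. ennreal (f x))"
    and ij: "i \<noteq> j"
    and G: "\<And>z. diff_density_ext f i j z \<le> ennreal G"
    and h [measurable]: "h \<in> borel_measurable borel"
  shows "(\<integral>\<^sup>+\<omega>. h (X \<omega> $ j - X \<omega> $ i) \<partial>M) \<le> ennreal G * (\<integral>\<^sup>+z. h z \<partial>lborel)"
proof -
  have f: "(\<lambda>x. ennreal (f x)) \<in> borel_measurable borel"
    using distributed_borel_measurable[OF X] by simp
  have [measurable]: "(\<lambda>v::real^'n. v $ k) \<in> borel_measurable borel" for k
    by (intro borel_measurable_continuous_onI continuous_intros)
  have "(\<integral>\<^sup>+\<omega>. h (X \<omega> $ j - X \<omega> $ i) \<partial>M)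
      = (\<integral>\<^sup>+v. ennreal (f v) * h (v $ j - v $ i) \<partial>lborel)"
    by (rule distributed_nn_integral[OF X, symmetric]) measurable
  also have "\<dots> = (\<integral>\<^sup>+z. diff_density_ext f i j z * h z \<partial>lborel)"
    by (rule nn_integral_diff_density[OF ij f h])
  also have "\<dots> \<le> (\<integral>\<^sup>+z. ennreal G * h z \<partial>lborel)"
    by (intro nn_integral_mono mult_right_mono G) simp
  also have "\<dots> = ennreal G * (\<integral>\<^sup>+z. h z \<partial>lborel)"
    by (rule nn_integral_cmult) simp
  finally show ?thesis .
qed

text \<open>
  The bound by the minimum makes the constant symmetric in \<open>i\<close> and \<open>j\<close>. It comes from
  integrating against the law of \<open>X\<^sub>j - X\<^sub>i\<close> or of \<open>X\<^sub>i - X\<^sub>j\<close>, which avoids comparing the two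
  densities pointwise.
\<close>

lemma expectation_hinge_le:
  fixes X :: "'a \<Rightarrow> real ^ 'n"
  assumes X: "distributed M lborel X (\<lambda>x. ennreal (f x))"
    and ij: "i \<noteq> j"
    and G: "\<And>z. diff_density_ext f i j z \<le> ennreal G" "0 \<le> G"
    and G': "\<And>z. diff_density_ext f j i z \<le> ennreal G'" "0 \<le> G'"
  shows "(\<integral>\<omega>. hinge c (d - (X \<omega> $ j - X \<omega> $ i)) \<partial>M) \<le> min G G' * ((max 0 c)\<^sup>2 / 2)"
proof -
  have shift: "(\<integral>\<^sup>+z. ennreal (hinge c (d + b * z)) \<partial>lborel) = ennreal ((max 0 c)\<^sup>2 / 2)"
    if "b = 1 \<or> b = -1" for b :: real
    using that nn_integral_hinge[of c]
      nn_integral_real_affine[of "\<lambda>z. ennreal (hinge c z)" b d] by auto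
  have "(\<integral>\<^sup>+\<omega>. ennreal (hinge c (d + -1 * (X \<omega> $ j - X \<omega> $ i))) \<partial>M)
      \<le> ennreal G * ennreal ((max 0 c)\<^sup>2 / 2)"
    using nn_integral_difference_le[OF X ij G(1), of "\<lambda>z. ennreal (hinge c (d + -1 * z))"]
      shift[of "-1"] by simp
  moreover have "(\<integral>\<^sup>+\<omega>. ennreal (hinge c (d + 1 * (X \<omega> $ i - X \<omega> $ j))) \<partial>M)
      \<le> ennreal G' * ennreal ((max 0 c)\<^sup>2 / 2)"
    using nn_integral_difference_le[OF X ij[symmetric] G'(1), of "\<lambda>z. ennreal (hinge c (d + 1 * z))"]
      shift[of 1] by simp
  ultimately have le: "(\<integral>\<^sup>+\<omega>. ennreal (hinge c (d - (X \<omega> $ j - X \<omega> $ i))) \<partial>M)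
      \<le> ennreal (min G G' * ((max 0 c)\<^sup>2 / 2))"
    using G(2) G'(2) by (simp add: ennreal_mult'[symmetric] min_def algebra_simps)
  show ?thesis
    using G(2) G'(2) le by (intro integral_real_bounded) auto
qed

section \<open>Smoothness of the surplus function\<close>

lemma sum_offdiag_swap:
  fixes h :: "'n::finite \<Rightarrow> 'n \<Rightarrow> 'b::comm_monoid_add"
  shows "(\<Sum>i\<in>UNIV. \<Sum>j\<in>UNIV - {i}. h i j) = (\<Sum>i\<in>UNIV. \<Sum>j\<in>UNIV - {i}. h j i)"
proof -
  have eq: "UNIV - {i} = {j \<in> UNIV. i \<noteq> j}" "UNIV - {i} = {j \<in> UNIV. j \<noteq> i}" for i :: 'n
    by auto
  have "(\<Sum>i\<in>UNIV. \<Sum>j\<in>{j \<in> UNIV. i \<noteq> j}. h i j) = (\<Sum>j\<in>UNIV. \<Sum>i\<in>{i \<in> UNIV. i \<noteq> j}. h i j)"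
    by (rule sum.swap_restrict) auto
  then show ?thesis
    unfolding eq(2)[symmetric] eq(1)[symmetric] .
qed

text \<open>
  For symmetric weights, pairing \<open>(i, j)\<close> with \<open>(j, i)\<close> leaves \<open>(r\<^sub>j - r\<^sub>i)\<^sup>2 / 2 \<le> 2 t\<^sup>2\<close> for each
  unordered pair. This saves a factor \<open>2\<close> over the bound of each term by itself.
\<close>

lemma sum_max_square_le:
  fixes m :: "'n::finite \<Rightarrow> 'n \<Rightarrow> real" and r :: "'n \<Rightarrow> real"
  assumes sym: "\<And>i j. m i j = m j i" and nonneg: "\<And>i j. 0 \<le> m i j"
    and r: "\<And>k. \<bar>r k\<bar> \<le> t"
  shows "(\<Sum>i\<in>UNIV. \<Sum>j\<in>UNIV - {i}. m i j * ((max 0 (r j - r i))\<^sup>2 / 2))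
    \<le> t\<^sup>2 * (\<Sum>i\<in>UNIV. \<Sum>j\<in>UNIV - {i}. m i j)" (is "?S \<le> _")
proof -
  have "?S = (\<Sum>i\<in>UNIV. \<Sum>j\<in>UNIV - {i}. m i j * ((max 0 (r i - r j))\<^sup>2 / 2))"
    by (subst sum_offdiag_swap) (simp add: sym)
  then have "2 * ?S = (\<Sum>i\<in>UNIV. \<Sum>j\<in>UNIV - {i}.
      m i j * ((max 0 (r j - r i))\<^sup>2 / 2) + m i j * ((max 0 (r i - r j))\<^sup>2 / 2))"
    by (simp add: sum.distrib)
  also have "\<dots> \<le> (\<Sum>i\<in>UNIV. \<Sum>j\<in>UNIV - {i}. 2 * (t\<^sup>2 * m i j))"
  proof (intro sum_mono)
    fix i j
    have "(max 0 (r j - r i))\<^sup>2 + (max 0 (r i - r j))\<^sup>2 = (r j - r i)\<^sup>2"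
      by (auto simp: max_def power2_eq_square algebra_simps)
    also have "\<dots> \<le> (2 * t)\<^sup>2"
      using r[of i] r[of j] by (intro abs_le_square_iff[THEN iffD1]) auto
    finally have "m i j * ((max 0 (r j - r i))\<^sup>2 + (max 0 (r i - r j))\<^sup>2) \<le> m i j * (2 * t)\<^sup>2"
      by (intro mult_left_mono nonneg)
    then show "m i j * ((max 0 (r j - r i))\<^sup>2 / 2) + m i j * ((max 0 (r i - r j))\<^sup>2 / 2)
        \<le> 2 * (t\<^sup>2 * m i j)"
      by (simp add: algebra_simps power2_eq_square)
  qed
  also have "\<dots> = 2 * (t\<^sup>2 * (\<Sum>i\<in>UNIV. \<Sum>j\<in>UNIV - {i}. m i j))"
    by (simp add: sum_distrib_left)
  finally show ?thesis by simp
qed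

lemma integrable_surplus:
  fixes X :: "'a \<Rightarrow> real ^ 'n"
  assumes "prob_space M" "integrable M X"
  shows "integrable M (\<lambda>\<omega>. MAX i. u $ i + X \<omega> $ i)"
proof -
  interpret prob_space M by fact
  have "integrable M (\<lambda>\<omega>. X \<omega> $ i)" for i
    using integrable_inner_left[OF assms(2), of "axis i 1"] by (simp add: inner_axis)
  then show ?thesis
    by (intro integrable_MAX) auto
qed

text \<open>
  With \<open>L / 2\<close> the sum of the weights, the conclusion is smoothness of the surplus with constant
  \<open>L\<close> for the maximum norm, stated as a reverse convexity inequality.
\<close>

lemma surplus_smooth:
  fixes X :: "'a \<Rightarrow> real ^ 'n" and m :: "'n \<Rightarrow> 'n \<Rightarrow> real"
  assumes M: "prob_space M" and X: "integrable M X"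
    and sym: "\<And>i j. m i j = m j i" and nonneg: "\<And>i j. 0 \<le> m i j"
    and m: "\<And>i j c d. i \<noteq> j \<Longrightarrow>
      (\<integral>\<omega>. hinge c (d - (X \<omega> $ j - X \<omega> $ i)) \<partial>M) \<le> m i j * ((max 0 c)\<^sup>2 / 2)"
    and \<alpha>: "0 \<le> \<alpha>" "\<alpha> \<le> 1" and s: "\<And>k. \<bar>s $ k\<bar> \<le> t"
  shows "\<alpha> * surplus M X (u + (1 - \<alpha>) *\<^sub>R s) + (1 - \<alpha>) * surplus M X (u - \<alpha> *\<^sub>R s)
    \<le> surplus M X u + \<alpha> * (1 - \<alpha>) * t\<^sup>2 * (\<Sum>i\<in>UNIV. \<Sum>j\<in>UNIV - {i}. m i j)"
proof -
  interpret prob_space M by fact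
  have Xk [measurable]: "(\<lambda>\<omega>. X \<omega> $ k) \<in> borel_measurable M" for k
    using integrable_inner_left[OF X, of "axis k 1"] by (auto simp: inner_axis)
  define H where "H r \<omega> = (\<Sum>i\<in>UNIV. \<Sum>j\<in>UNIV - {i}.
      hinge (r $ j - r $ i) ((u $ i - u $ j) - (X \<omega> $ j - X \<omega> $ i)))" for r :: "real ^ 'n" and \<omega>
  have hinge_int: "integrable M (\<lambda>\<omega>. hinge c (d - (X \<omega> $ j - X \<omega> $ i)))" for c d i j
    by (rule integrable_const_bound[where B="max 0 c"])
       (auto simp: hinge_nonneg hinge_le)
  then have H_int: "integrable M (H r)" for r
    unfolding H_def[abs_def] by (intro Bochner_Integration.integrable_sum)
  have H_le: "(\<integral>\<omega>. H r \<omega> \<partial>M) \<le> \<tau>\<^sup>2 * (\<Sum>i\<in>UNIV. \<Sum>j\<in>UNIV - {i}. m i j)"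
    if "\<And>k. \<bar>r $ k\<bar> \<le> \<tau>" for r \<tau>
  proof -
    have "(\<integral>\<omega>. H r \<omega> \<partial>M) = (\<Sum>i\<in>UNIV. \<Sum>j\<in>UNIV - {i}.
        (\<integral>\<omega>. hinge (r $ j - r $ i) ((u $ i - u $ j) - (X \<omega> $ j - X \<omega> $ i)) \<partial>M))"
      unfolding H_def by (simp add: hinge_int)
    also have "\<dots> \<le> (\<Sum>i\<in>UNIV. \<Sum>j\<in>UNIV - {i}. m i j * ((max 0 (r $ j - r $ i))\<^sup>2 / 2))"
      by (intro sum_mono m) auto
    also have "\<dots> \<le> \<tau>\<^sup>2 * (\<Sum>i\<in>UNIV. \<Sum>j\<in>UNIV - {i}. m i j)"
      by (rule sum_max_square_le[OF sym nonneg that])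
    finally show ?thesis .
  qed
  let ?s1 = "(1 - \<alpha>) *\<^sub>R s" and ?s2 = "- (\<alpha> *\<^sub>R s)"
  let ?mx = "\<lambda>v \<omega>. MAX i. v $ i + X \<omega> $ i"
  note mx_int = integrable_surplus[OF M X]
  have pointwise: "\<alpha> * ?mx (u + ?s1) \<omega> + (1 - \<alpha>) * ?mx (u + ?s2) \<omega>
      \<le> ?mx u \<omega> + \<alpha> * H ?s1 \<omega> + (1 - \<alpha>) * H ?s2 \<omega>" for \<omega>
  proof -
    define a where "a k = u $ k + X \<omega> $ k" for k
    have "Max (range a) \<in> range a"
      by (intro Max_in) auto
    then obtain i where i: "a i = Max (range a)"
      by (metis rangeE)
    then have i': "a k \<le> a i" for k
      by simp
    have le: "?mx (u + r) \<omega> \<le> a i + r $ i + H r \<omega>" for r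
      using Max_add_le_hinge[of a i "($) r", OF i'] by (simp add: a_def H_def algebra_simps)
    have "\<alpha> * ?mx (u + ?s1) \<omega> + (1 - \<alpha>) * ?mx (u + ?s2) \<omega>
        \<le> \<alpha> * (a i + ?s1 $ i + H ?s1 \<omega>) + (1 - \<alpha>) * (a i + ?s2 $ i + H ?s2 \<omega>)"
      using \<alpha> by (intro add_mono mult_left_mono le) auto
    \<comment> \<open>The linear terms cancel because \<open>\<alpha> (1 - \<alpha>) s - (1 - \<alpha>) \<alpha> s = 0\<close>.\<close>
    also have "\<dots> = a i + \<alpha> * H ?s1 \<omega> + (1 - \<alpha>) * H ?s2 \<omega>"
      by (simp add: algebra_simps)
    also have "a i = ?mx u \<omega>"
      using i by (simp only: a_def[abs_def])
    finally show ?thesis .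
  qed
  have "\<alpha> * surplus M X (u + ?s1) + (1 - \<alpha>) * surplus M X (u + ?s2)
      = (\<integral>\<omega>. \<alpha> * ?mx (u + ?s1) \<omega> + (1 - \<alpha>) * ?mx (u + ?s2) \<omega> \<partial>M)"
    unfolding surplus_def
    by (simp only: Bochner_Integration.integral_add integrable_mult_right mx_int
      integral_mult_right_zero)
  also have "\<dots> \<le> (\<integral>\<omega>. ?mx u \<omega> + \<alpha> * H ?s1 \<omega> + (1 - \<alpha>) * H ?s2 \<omega> \<partial>M)"
    by (rule integral_mono[OF _ _ pointwise])
       (simp_all only: Bochner_Integration.integrable_add integrable_mult_right mx_int H_int)
  also have "\<dots> = surplus M X u + \<alpha> * (\<integral>\<omega>. H ?s1 \<omega> \<partial>M) + (1 - \<alpha>) * (\<integral>\<omega>. H ?s2 \<omega> \<partial>M)"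
    unfolding surplus_def
    by (simp only: Bochner_Integration.integral_add Bochner_Integration.integrable_add
      integrable_mult_right mx_int H_int integral_mult_right_zero)
  also have "\<dots> \<le> surplus M X u
      + \<alpha> * (((1 - \<alpha>) * t)\<^sup>2 * (\<Sum>i\<in>UNIV. \<Sum>j\<in>UNIV - {i}. m i j))
      + (1 - \<alpha>) * ((\<alpha> * t)\<^sup>2 * (\<Sum>i\<in>UNIV. \<Sum>j\<in>UNIV - {i}. m i j))"
    using \<alpha> s by (intro add_mono mult_left_mono H_le) (auto simp: abs_mult intro!: mult_left_mono)
  also have "\<dots> = surplus M X u + \<alpha> * (1 - \<alpha>) * t\<^sup>2 * (\<Sum>i\<in>UNIV. \<Sum>j\<in>UNIV - {i}. m i j)"
    by (simp add: algebra_simps power2_eq_square)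
  finally show ?thesis by simp
qed

section \<open>The convex conjugate\<close>

text \<open>
  The maximum dominates every convex combination of the coordinates, which bounds the conjugate
  at \<open>p\<close> by \<open>- p \<bullet> \<integral>X\<close>.
\<close>

lemma convex_conjugate_surplus_finite:
  fixes X :: "'a \<Rightarrow> real ^ 'n"
  assumes M: "prob_space M" and X: "integrable M X" and p: "p \<in> prob_simplex"
  shows "\<bar>convex_conjugate (surplus M X) p\<bar> \<noteq> \<infinity>"
proof -
  interpret prob_space M by fact
  have "p \<bullet> u - surplus M X u \<le> - (p \<bullet> (\<integral>\<omega>. X \<omega> \<partial>M))" for u
  proof -
    have "p \<bullet> u + p \<bullet> (\<integral>\<omega>. X \<omega> \<partial>M) = (\<integral>\<omega>. p \<bullet> u + p \<bullet> X \<omega> \<partial>M)"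
      using X by (simp add: prob_space)
    also have "\<dots> \<le> (\<integral>\<omega>. (MAX i. u $ i + X \<omega> $ i) \<partial>M)"
    proof (intro integral_mono integrable_surplus[OF M X])
      fix \<omega>
      have "p \<bullet> u + p \<bullet> X \<omega> = (\<Sum>i\<in>UNIV. p $ i * (u $ i + X \<omega> $ i))"
        by (simp add: inner_vec_def sum.distrib algebra_simps)
      also have "\<dots> \<le> (\<Sum>i\<in>UNIV. p $ i * (MAX i. u $ i + X \<omega> $ i))"
        using p by (intro sum_mono mult_left_mono) (auto simp: prob_simplex_def)
      also have "\<dots> = (MAX i. u $ i + X \<omega> $ i)"
        using p by (simp add: prob_simplex_def sum_distrib_right[symmetric])
      finally show "p \<bullet> u + p \<bullet> X \<omega> \<le> (MAX i. u $ i + X \<omega> $ i)" .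
    qed (use X in auto)
    finally show ?thesis
      by (simp add: surplus_def)
  qed
  then have "convex_conjugate (surplus M X) p \<le> ereal (- (p \<bullet> (\<integral>\<omega>. X \<omega> \<partial>M)))"
    unfolding convex_conjugate_def by (intro SUP_least) simp
  moreover have "ereal (p \<bullet> 0 - surplus M X 0) \<le> convex_conjugate (surplus M X) p"
    unfolding convex_conjugate_def by (rule SUP_upper) simp
  ultimately show ?thesis
    by (cases "convex_conjugate (surplus M X) p") auto
qed

text \<open>
  Smoothness of \<open>F\<close> for the maximum norm implies strong convexity of its conjugate for the dual
  norm. The suprema need not be attained.
\<close>

lemma strongly_convex_conjugate_if_smooth:
  fixes F :: "real ^ 'n \<Rightarrow> real"
  assumes L: "0 < L"
    and smooth: "\<And>\<alpha> t u s. 0 \<le> \<alpha> \<Longrightarrow> \<alpha> \<le> 1 \<Longrightarrow> (\<And>k. \<bar>s $ k\<bar> \<le> t) \<Longrightarrow>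
      \<alpha> * F (u + (1 - \<alpha>) *\<^sub>R s) + (1 - \<alpha>) * F (u - \<alpha> *\<^sub>R s) \<le> F u + \<alpha> * (1 - \<alpha>) * (L / 2) * t\<^sup>2"
    and fin: "\<And>p. p \<in> S \<Longrightarrow> \<bar>convex_conjugate F p\<bar> \<noteq> \<infinity>"
  shows "strongly_convex_l1_on S (1 / L) (convex_conjugate F)"
  unfolding strongly_convex_l1_on_def
proof (intro conjI ballI)
  fix p q :: "real ^ 'n" and \<alpha> :: real
  assume p: "p \<in> S" and q: "q \<in> S" and \<alpha>: "\<alpha> \<in> {0..1}"
  obtain P Q where P: "convex_conjugate F p = ereal P" and Q: "convex_conjugate F q = ereal Q"
    using fin[OF p] fin[OF q] by auto
  have le: "r \<bullet> v - F v \<le> R" if "convex_conjugate F r = ereal R" for r v R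
    using SUP_upper[of v UNIV "\<lambda>v. ereal (r \<bullet> v - F v)"] that
    by (simp add: convex_conjugate_def)
  define N where "N = l1_norm (p - q)"
  \<comment> \<open>The sign vector attains equality in Hoelder's inequality for \<open>(p - q) \<bullet> s\<close>, and \<open>t = N / L\<close>
    maximises the gain \<open>t N - L t\<^sup>2 / 2\<close>.\<close>
  define t where "t = N / L"
  define s :: "real ^ 'n" where "s = (\<chi> k. t * sgn ((p - q) $ k))"
  have "0 \<le> N"
    by (simp add: N_def l1_norm_def sum_nonneg)
  then have "0 \<le> t"
    using L by (simp add: t_def)
  then have s: "\<bar>s $ k\<bar> \<le> t" for k
    by (simp add: s_def abs_mult sgn_if)
  have "(p - q) \<bullet> s = (\<Sum>k\<in>UNIV. t * \<bar>(p - q) $ k\<bar>)"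
    unfolding inner_vec_def s_def by (intro sum.cong refl) (simp add: sgn_if)
  then have pqs: "(p - q) \<bullet> s = t * N"
    by (simp add: N_def l1_norm_def sum_distrib_left)
  have gain: "t * N - L / 2 * t\<^sup>2 = 1 / L / 2 * N\<^sup>2"
    using L by (simp add: t_def power2_eq_square field_simps)
  have "(\<alpha> *\<^sub>R p + (1 - \<alpha>) *\<^sub>R q) \<bullet> u - F u
      \<le> \<alpha> * P + (1 - \<alpha>) * Q - 1 / L / 2 * \<alpha> * (1 - \<alpha>) * N\<^sup>2" for u
  proof -
    have "\<alpha> * (p \<bullet> (u + (1 - \<alpha>) *\<^sub>R s) - F (u + (1 - \<alpha>) *\<^sub>R s))
        + (1 - \<alpha>) * (q \<bullet> (u - \<alpha> *\<^sub>R s) - F (u - \<alpha> *\<^sub>R s)) \<le> \<alpha> * P + (1 - \<alpha>) * Q"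
      using \<alpha> by (intro add_mono mult_left_mono le P Q) auto
    moreover have "\<alpha> * (p \<bullet> (u + (1 - \<alpha>) *\<^sub>R s)) + (1 - \<alpha>) * (q \<bullet> (u - \<alpha> *\<^sub>R s))
        = (\<alpha> *\<^sub>R p + (1 - \<alpha>) *\<^sub>R q) \<bullet> u + \<alpha> * (1 - \<alpha>) * ((p - q) \<bullet> s)"
      by (simp add: inner_add_left inner_add_right inner_diff_left inner_diff_right algebra_simps)
    moreover have "\<alpha> * F (u + (1 - \<alpha>) *\<^sub>R s) + (1 - \<alpha>) * F (u - \<alpha> *\<^sub>R s)
        \<le> F u + \<alpha> * (1 - \<alpha>) * (L / 2) * t\<^sup>2"
      using \<alpha> by (intro smooth s) auto
    moreover have "\<alpha> * (1 - \<alpha>) * ((p - q) \<bullet> s) - \<alpha> * (1 - \<alpha>) * (L / 2) * t\<^sup>2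
        = 1 / L / 2 * \<alpha> * (1 - \<alpha>) * N\<^sup>2"
      using arg_cong[OF gain, of "\<lambda>x. \<alpha> * (1 - \<alpha>) * x"] unfolding pqs
      by (simp add: algebra_simps diff_divide_distrib)
    ultimately show ?thesis
      by (simp only: right_diff_distrib)
  qed
  then have "convex_conjugate F (\<alpha> *\<^sub>R p + (1 - \<alpha>) *\<^sub>R q)
      \<le> ereal (\<alpha> * P + (1 - \<alpha>) * Q - 1 / L / 2 * \<alpha> * (1 - \<alpha>) * N\<^sup>2)"
    unfolding convex_conjugate_def by (intro SUP_least) simp
  then show "convex_conjugate F (\<alpha> *\<^sub>R p + (1 - \<alpha>) *\<^sub>R q)
      \<le> ereal \<alpha> * convex_conjugate F p + ereal (1 - \<alpha>) * convex_conjugate F q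
        - ereal (1 / L / 2 * \<alpha> * (1 - \<alpha>) * (l1_norm (p - q))\<^sup>2)"
    by (simp add: P Q N_def)
qed (use L fin in auto)

theorem theorem2:
  fixes M :: "'a measure"
    and \<epsilon> :: "'a \<Rightarrow> real ^ 'n"
    and f :: "real ^ 'n \<Rightarrow> real"
    and zbar :: "'n \<Rightarrow> 'n \<Rightarrow> real"
  assumes "CARD('n) \<ge> 2"
    and "prob_space M"
    and "integrable M \<epsilon>"
    and "\<And>x. 0 \<le> f x"
    and "distributed M lborel \<epsilon> (\<lambda>x. ennreal (f x))"
    and "measure_support (distr M borel \<epsilon>) = UNIV"
    and "twice_differentiable (surplus M \<epsilon>)"
    and "\<And>i j z. i \<noteq> j \<Longrightarrow> diff_density_ext f i j z < \<infinity>"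
    and "\<And>i j. i \<noteq> j \<Longrightarrow> is_mode (diff_density f i j) (zbar i j)"
  shows "strongly_convex_l1_on prob_simplex
           (1 / (2 * (\<Sum>i\<in>UNIV. \<Sum>j\<in>UNIV - {i}. diff_density f i j (zbar i j))))
           (convex_conjugate (surplus M \<epsilon>))"
proof -
  note prob = assms(2) and int = assms(3) and dens = assms(5)
  interpret prob_space M by fact
  define G where "G i j = diff_density f i j (zbar i j)" for i j
  define m where "m i j = min (G i j) (G j i)" for i j
  define \<Sigma> where "\<Sigma> = (\<Sum>i\<in>UNIV. \<Sum>j\<in>UNIV - {i}. G i j)"
  have G_nonneg: "0 \<le> G i j" for i j
    by (simp add: G_def diff_density_def)
  have G: "diff_density_ext f i j z \<le> ennreal (G i j)" if "i \<noteq> j" for i j z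
  proof -
    have "diff_density_ext f i j z = ennreal (diff_density f i j z)"
      using assms(8)[OF that, of z] by (simp add: diff_density_def less_top)
    also have "\<dots> \<le> ennreal (G i j)"
      using assms(9)[OF that] by (simp add: is_mode_def G_def ennreal_leI)
    finally show ?thesis .
  qed
  have "0 < \<Sigma>"
  proof -
    obtain i j :: 'n where ij: "i \<noteq> j"
      using assms(1) card_le_Suc0_iff_eq[of "UNIV :: 'n set"] by auto
    \<comment> \<open>A probability density cannot vanish identically.\<close>
    have "1 \<le> ennreal (G i j) * (\<integral>\<^sup>+z. 1 \<partial>lborel)"
      using nn_integral_difference_le[OF dens ij G[OF ij], of "\<lambda>_. 1"] emeasure_space_1 by simp
    then have "G i j \<noteq> 0"
      by auto
    then have "0 < G i j"
      using G_nonneg[of i j] by simp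
    also have "\<dots> \<le> (\<Sum>j\<in>UNIV - {i}. G i j)"
      using ij by (intro member_le_sum) (auto simp: G_nonneg)
    also have "\<dots> \<le> \<Sigma>"
      unfolding \<Sigma>_def
      by (rule member_le_sum[where i=i and f="\<lambda>i. \<Sum>j\<in>UNIV - {i}. G i j"])
         (auto intro!: sum_nonneg G_nonneg)
    finally show ?thesis .
  qed
  have m_le: "(\<Sum>i\<in>UNIV. \<Sum>j\<in>UNIV - {i}. m i j) \<le> \<Sigma>"
    unfolding \<Sigma>_def m_def by (intro sum_mono) simp
  have "strongly_convex_l1_on prob_simplex (1 / (2 * \<Sigma>)) (convex_conjugate (surplus M \<epsilon>))"
  proof (rule strongly_convex_conjugate_if_smooth)
    fix \<alpha> t :: real and u s :: "real ^ 'n"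
    assume \<alpha>: "0 \<le> \<alpha>" "\<alpha> \<le> 1" and s: "\<And>k. \<bar>s $ k\<bar> \<le> t"
    have "\<alpha> * surplus M \<epsilon> (u + (1 - \<alpha>) *\<^sub>R s) + (1 - \<alpha>) * surplus M \<epsilon> (u - \<alpha> *\<^sub>R s)
        \<le> surplus M \<epsilon> u + \<alpha> * (1 - \<alpha>) * t\<^sup>2 * (\<Sum>i\<in>UNIV. \<Sum>j\<in>UNIV - {i}. m i j)"
    proof (rule surplus_smooth[OF prob int _ _ _ \<alpha> s])
      show "(\<integral>\<omega>. hinge c (d - (\<epsilon> \<omega> $ j - \<epsilon> \<omega> $ i)) \<partial>M) \<le> m i j * ((max 0 c)\<^sup>2 / 2)"
        if "i \<noteq> j" for i j c d
        unfolding m_def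
        by (rule expectation_hinge_le[OF dens that G[OF that] G_nonneg G[OF that[symmetric]] G_nonneg])
    qed (auto simp: m_def G_nonneg)
    also have "\<dots> \<le> surplus M \<epsilon> u + \<alpha> * (1 - \<alpha>) * t\<^sup>2 * \<Sigma>"
      using \<alpha> by (intro add_left_mono mult_left_mono m_le) auto
    finally show "\<alpha> * surplus M \<epsilon> (u + (1 - \<alpha>) *\<^sub>R s) + (1 - \<alpha>) * surplus M \<epsilon> (u - \<alpha> *\<^sub>R s)
        \<le> surplus M \<epsilon> u + \<alpha> * (1 - \<alpha>) * (2 * \<Sigma> / 2) * t\<^sup>2"
      by (simp add: mult_ac)
  qed (use \<open>0 < \<Sigma>\<close> convex_conjugate_surplus_finite[OF prob int] in auto)
  then show ?thesis
    by (simp only: \<Sigma>_def G_def)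
qed

end
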